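(* Let $n\ge 1$ be an integer, let $T_n$ be an $n$-dimensional simplex in $\mathbb{E}^n$, and let $\mu,\nu$ be positive real numbers. Then $$\frac{\mathrm{vol}(\mu T_n-\nu T_n)}{\mathrm{vol}(T_n)}=\sum_{i=0}^n\binom{n}{i}^2\mu^i\nu^{n-i}.$$
   Context: $\mathbb{E}^n$ is $n$-dimensional Euclidean space and $\mathrm{vol}$ is $n$-dimensional volume (Lebesgue measure). An $n$-dimensional simplex is the convex hull of $n+1$ affinely independent points of $\mathbb{E}^n$. For a set $K\subset\mathbb{E}^n$ and $\mu,\nu>0$, $\mu K-\nu K=\{\mu\mathbf{x}_1-\nu\mathbf{x}_2:\ \mathbf{x}_1,\mathbf{x}_2\in K\}$ (Minkowski sum of $\mu K$ and $-\nu K$). *)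

theory Defs
  imports "HOL-Analysis.Analysis"
begin

end

theory Submission
  imports Defs
begin

text \<open>
  All simplices are affinely equivalent, and an affine map multiplies all volumes by the same factor,
  so \<open>T\<close> may be replaced by the standard simplex \<open>S\<close>, of volume \<open>1 / n!\<close>.
  A point \<open>z\<close> lies in \<open>\<mu> S - \<nu> S\<close> iff its positive parts sum to at most \<open>\<mu>\<close> and its negative
  parts to at most \<open>\<nu>\<close>. The orthants split this body into products of two simplices: those with \<open>i\<close>
  positive coordinates contribute \<open>binomial(n, i) \<mu>^i / i! * \<nu>^(n - i) / (n - i)!\<close>. The volume is
  computed by integrating out one coordinate at a time, which turns this into Pascal's rule.
\<close>

section \<open>Translations, reflections and linear bijections\<close>

text \<open>Translations and point reflections are handled together, since in both cases the
  Jacobian factor is 1.\<close>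

lemma nn_integral_lborel_shift:
  fixes t :: "'a::euclidean_space" and f :: "'a \<Rightarrow> ennreal"
  assumes [measurable]: "f \<in> borel_measurable borel" and "\<bar>c\<bar> = 1"
  shows "(\<integral>\<^sup>+ x. f (t + c *\<^sub>R x) \<partial>lborel) = (\<integral>\<^sup>+ x. f x \<partial>lborel)"
proof -
  have "(lborel :: 'a measure) = density (distr lborel borel (\<lambda>x. t + c *\<^sub>R x)) (\<lambda>_. \<bar>c\<bar>^DIM('a))"
    using assms(2) by (intro lborel_affine) auto
  also have "\<dots> = distr lborel borel (\<lambda>x. t + c *\<^sub>R x)"
    using assms(2) by (simp add: density_1)
  finally have eq: "(lborel :: 'a measure) = distr lborel borel (\<lambda>x. t + c *\<^sub>R x)" .
  show ?thesis
    by (subst (2) eq, subst nn_integral_distr) auto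
qed

lemma linear_inv_bij:
  assumes "linear f" "bij f"
  shows "linear (inv f)"
proof -
  have f_inv: "f (inv f x) = x" and inv_f: "inv f (f y) = y" for x y
    using assms(2) by (auto simp: bij_def surj_f_inv_f)
  show ?thesis
  proof (rule linearI)
    show "inv f (x + y) = inv f x + inv f y" for x y
      using inv_f[of "inv f x + inv f y"] by (simp add: linear_add[OF assms(1)] f_inv)
    show "inv f (c *\<^sub>R x) = c *\<^sub>R inv f x" for c x
      using inv_f[of "c *\<^sub>R inv f x"] by (simp add: linear_scale[OF assms(1)] f_inv)
  qed
qed

text \<open>
  The uniqueness argument for Haar measure: both sides are iterated integrals of
  \<open>1\<^sub>B (y + f\<^sup>-\<^sup>1 u) 1\<^sub>C y\<close>, taken in either order. This avoids determinants, for which the library's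
  change of variables needs a well-ordered index type.
\<close>

lemma emeasure_linear_image_ratio:
  fixes f :: "'a::euclidean_space \<Rightarrow> 'b::euclidean_space"
  assumes "linear f" "bij f"
    and [measurable]: "B \<in> sets borel" "C \<in> sets borel"
  shows "emeasure lborel (f ` B) * emeasure lborel C = emeasure lborel B * emeasure lborel (f ` C)"
proof -
  define h where "h = inv f"
  have lin: "linear h"
    unfolding h_def using assms(1,2) by (rule linear_inv_bij)
  have hf: "h (f x) = x" and fh: "f (h y) = y" for x y
    using assms(2) by (auto simp: h_def bij_def surj_f_inv_f)
  have h_meas [measurable]: "h \<in> borel_measurable borel" and [measurable]: "f \<in> borel_measurable borel"
    using lin \<open>linear f\<close> by (auto intro!: borel_measurable_continuous_onI linear_continuous_on
        simp: linear_conv_bounded_linear)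
  have image_eq: "f ` A = h -` A" for A
    using hf fh by (auto simp: image_iff) metis
  have image_meas [measurable]: "f ` A \<in> sets borel" if "A \<in> sets borel" for A
    unfolding image_eq using measurable_sets[OF h_meas that] by simp
  have em: "emeasure lborel (f ` A) = (\<integral>\<^sup>+ u. indicator A (h u) \<partial>lborel)" if "A \<in> sets borel" for A
    using nn_integral_indicator[of "f ` A" lborel] image_meas[OF that]
    by (simp add: image_eq indicator_vimage[unfolded comp_def] indicator_def)
  have pair: "pair_sigma_finite (lborel :: 'b measure) (lborel :: 'a measure)" ..
  have "emeasure lborel (f ` B) * emeasure lborel C
      = (\<integral>\<^sup>+ y. (\<integral>\<^sup>+ u. indicator B (h u) \<partial>lborel) * indicator C y \<partial>lborel)"
    by (simp add: nn_integral_cmult em)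
  \<comment> \<open>Translating \<open>u\<close> by \<open>f y\<close> leaves the inner integral
    unchanged and, since \<open>h\<close> is linear with \<open>h (f y) = y\<close>, couples the two
    sets.\<close>
  also have "\<dots> = (\<integral>\<^sup>+ y. (\<integral>\<^sup>+ u. indicator B (h (f y + 1 *\<^sub>R u)) \<partial>lborel) * indicator C y \<partial>lborel)"
    by (subst nn_integral_lborel_shift) auto
  also have "\<dots> = (\<integral>\<^sup>+ y. (\<integral>\<^sup>+ u. indicator B (y + h u) * indicator C y \<partial>lborel) \<partial>lborel)"
    by (simp add: nn_integral_multc linear_add[OF lin] hf)
  also have "\<dots> = (\<integral>\<^sup>+ u. (\<integral>\<^sup>+ y. indicator B (y + h u) * indicator C y \<partial>lborel) \<partial>lborel)"
    by (rule pair_sigma_finite.Fubini'[OF pair]) simp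
  also have "\<dots> = (\<integral>\<^sup>+ u. (\<integral>\<^sup>+ y. indicator B y * indicator C (y - h u) \<partial>lborel) \<partial>lborel)"
  proof (rule nn_integral_cong)
    fix u
    show "(\<integral>\<^sup>+ y. indicator B (y + h u) * indicator C y \<partial>lborel)
        = (\<integral>\<^sup>+ y. indicator B y * indicator C (y - h u) \<partial>lborel)"
      using nn_integral_lborel_shift[of "\<lambda>y. indicator B y * indicator C (y - h u)" 1 "h u"]
      by (simp add: add_ac)
  qed
  also have "\<dots> = (\<integral>\<^sup>+ y. (\<integral>\<^sup>+ u. indicator B y * indicator C (y - h u) \<partial>lborel) \<partial>lborel)"
    by (rule pair_sigma_finite.Fubini'[OF pair, symmetric]) simp
  \<comment> \<open>Reading \<open>y - h u\<close> as \<open>h (f y - u)\<close> exposes the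
    reflection from \<open>u\<close> to \<open>f y - u\<close>, which removes \<open>y\<close> from
    the inner integral.\<close>
  also have "\<dots> = (\<integral>\<^sup>+ y. indicator B y * (\<integral>\<^sup>+ u. indicator C (h (f y + (-1) *\<^sub>R u)) \<partial>lborel) \<partial>lborel)"
    by (simp add: nn_integral_cmult linear_diff[OF lin] hf)
  also have "\<dots> = (\<integral>\<^sup>+ y. indicator B y * (\<integral>\<^sup>+ u. indicator C (h u) \<partial>lborel) \<partial>lborel)"
    by (subst nn_integral_lborel_shift) auto
  also have "\<dots> = emeasure lborel B * emeasure lborel (f ` C)"
    by (simp only: nn_integral_multc[OF borel_measurable_indicator] em assms sets_lborel nn_integral_indicator)
  finally show ?thesis .
qed

section \<open>The volume polynomial and its recursion\<close>

text \<open>The normalised powers are kept apart from the binomial coefficient, so that integrating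
  in \<open>s\<close> or \<open>t\<close> only raises an exponent.\<close>

definition posneg_vol :: "nat \<Rightarrow> real \<Rightarrow> real \<Rightarrow> real" where
  "posneg_vol n s t = (\<Sum>i\<le>n. real (n choose i) * (s ^ i / fact i * (t ^ (n - i) / fact (n - i))))"

text \<open>Pascal's rule: each coefficient splits according to whether the new element is chosen,
  which shifts the index, or not.\<close>

lemma sum_choose_Suc:
  fixes F :: "nat \<Rightarrow> 'a::comm_semiring_1"
  shows "(\<Sum>i\<le>Suc n. of_nat (Suc n choose i) * F i)
       = (\<Sum>i\<le>n. of_nat (n choose i) * F (Suc i)) + (\<Sum>i\<le>n. of_nat (n choose i) * F i)"
proof -
  have "(\<Sum>i\<le>Suc n. of_nat (n choose i) * F i) = F 0 + (\<Sum>i\<le>n. of_nat (n choose Suc i) * F (Suc i))"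
    by (subst sum.atMost_Suc_shift) simp
  \<comment> \<open>The top term vanishes because \<open>n choose Suc n = 0\<close>; this lets
    \<open>F 0\<close> be absorbed into the second sum.\<close>
  moreover have "(\<Sum>i\<le>Suc n. of_nat (n choose i) * F i) = (\<Sum>i\<le>n. of_nat (n choose i) * F i)"
    by (simp add: binomial_eq_0)
  ultimately have F0: "F 0 + (\<Sum>i\<le>n. of_nat (n choose Suc i) * F (Suc i)) = (\<Sum>i\<le>n. of_nat (n choose i) * F i)"
    by simp
  have "(\<Sum>i\<le>Suc n. of_nat (Suc n choose i) * F i) = F 0 +
      ((\<Sum>i\<le>n. of_nat (n choose i) * F (Suc i)) + (\<Sum>i\<le>n. of_nat (n choose Suc i) * F (Suc i)))"
    by (subst sum.atMost_Suc_shift) (simp add: sum.distrib distrib_right)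
  also have "\<dots> = (\<Sum>i\<le>n. of_nat (n choose i) * F (Suc i)) +
      (F 0 + (\<Sum>i\<le>n. of_nat (n choose Suc i) * F (Suc i)))"
    by (simp only: add_ac)
  finally show ?thesis
    unfolding F0 .
qed

lemma has_real_derivative_power_fact:
  "((\<lambda>x. (c + x) ^ Suc k / fact (Suc k)) has_real_derivative (c + x) ^ k / fact k) (at x within A)"
proof -
  have "((\<lambda>x. (c + x) ^ Suc k) has_real_derivative real (Suc k) * (c + x) ^ k) (at x within A)"
    by (rule derivative_eq_intros refl | simp del: of_nat_Suc)+
  from DERIV_cdivide[OF this, of "fact (Suc k)"] show ?thesis
    by (simp del: of_nat_Suc power_Suc add: fact_Suc)
qed

lemma has_real_derivative_power_fact':
  "((\<lambda>x. - ((c - x) ^ Suc k / fact (Suc k))) has_real_derivative (c - x) ^ k / fact k) (at x within A)"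
proof -
  have "((\<lambda>x. - ((c - x) ^ Suc k)) has_real_derivative real (Suc k) * (c - x) ^ k) (at x within A)"
    by (rule derivative_eq_intros refl | simp del: of_nat_Suc)+
  from DERIV_cdivide[OF this, of "fact (Suc k)"] show ?thesis
    by (simp del: of_nat_Suc power_Suc add: fact_Suc)
qed

lemma posneg_vol_nonneg: "s \<ge> 0 \<Longrightarrow> t \<ge> 0 \<Longrightarrow> posneg_vol n s t \<ge> 0"
  unfolding posneg_vol_def by (intro sum_nonneg mult_nonneg_nonneg) auto

text \<open>Here \<open>y\<close> is the coordinate being integrated out: a positive value uses up
  part of \<open>s\<close>, a negative one part of \<open>t\<close>. The integrals raise the
  exponents of \<open>s\<close> and \<open>t\<close> respectively, and Pascal's rule adds the
  coefficients.\<close>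

lemma posneg_vol_Suc:
  assumes "s \<ge> 0" "t \<ge> 0"
  shows "(\<integral>\<^sup>+ y\<in>{0..s}. ennreal (posneg_vol n (s - y) t) \<partial>lborel)
       + (\<integral>\<^sup>+ y\<in>{-t..0}. ennreal (posneg_vol n s (t + y)) \<partial>lborel)
       = ennreal (posneg_vol (Suc n) s t)"
proof -
  \<comment> \<open>The first integral yields \<open>G (Suc i)\<close> as
    \<open>Suc n - Suc i = n - i\<close>, the second \<open>G i\<close> as
    \<open>Suc (n - i) = Suc n - i\<close> for \<open>i \<le> n\<close>.\<close>
  define G where "G = (\<lambda>i. s ^ i / fact i * (t ^ (Suc n - i) / fact (Suc n - i)))"
  have 1: "(\<integral>\<^sup>+ y\<in>{0..s}. ennreal (posneg_vol n (s - y) t) \<partial>lborel)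
      = ennreal (\<Sum>i\<le>n. real (n choose i) * G (Suc i))"
  proof -
    define F where "F = (\<lambda>y. \<Sum>i\<le>n. real (n choose i) *
        (- ((s - y) ^ Suc i / fact (Suc i)) * (t ^ (n - i) / fact (n - i))))"
    have "(F has_real_derivative posneg_vol n (s - y) t) (at y)" for y
      unfolding F_def posneg_vol_def
      by (intro DERIV_sum DERIV_cmult DERIV_cmult_right has_real_derivative_power_fact')
    moreover have "(\<lambda>y. posneg_vol n (s - y) t) \<in> borel_measurable borel"
      unfolding posneg_vol_def by measurable
    ultimately have "(\<integral>\<^sup>+ y\<in>{0..s}. ennreal (posneg_vol n (s - y) t) \<partial>lborel) = ennreal (F s - F 0)"
      using assms by (intro nn_integral_FTC_Icc) (auto intro: posneg_vol_nonneg)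
    \<comment> \<open>\<open>F s\<close> vanishes, as every term has a positive power of
      \<open>s - s\<close>.\<close>
    also have "F s - F 0 = (\<Sum>i\<le>n. real (n choose i) * G (Suc i))"
      by (simp add: F_def G_def sum_negf)
    finally show ?thesis .
  qed
  have 2: "(\<integral>\<^sup>+ y\<in>{-t..0}. ennreal (posneg_vol n s (t + y)) \<partial>lborel)
      = ennreal (\<Sum>i\<le>n. real (n choose i) * G i)"
  proof -
    define F where "F = (\<lambda>y. \<Sum>i\<le>n. real (n choose i) *
        (s ^ i / fact i * ((t + y) ^ Suc (n - i) / fact (Suc (n - i)))))"
    have "(F has_real_derivative posneg_vol n s (t + y)) (at y)" for y
      unfolding F_def posneg_vol_def
      by (intro DERIV_sum DERIV_cmult has_real_derivative_power_fact)
    moreover have "(\<lambda>y. posneg_vol n s (t + y)) \<in> borel_measurable borel"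
      unfolding posneg_vol_def by measurable
    ultimately have "(\<integral>\<^sup>+ y\<in>{-t..0}. ennreal (posneg_vol n s (t + y)) \<partial>lborel) = ennreal (F 0 - F (-t))"
      using assms by (intro nn_integral_FTC_Icc) (auto intro: posneg_vol_nonneg)
    also have "F 0 - F (-t) = (\<Sum>i\<le>n. real (n choose i) * G i)"
      by (simp add: F_def G_def Suc_diff_le)
    finally show ?thesis .
  qed
  have "0 \<le> G i" for i
    using assms by (simp add: G_def)
  then have "ennreal (\<Sum>i\<le>n. real (n choose i) * G (Suc i)) + ennreal (\<Sum>i\<le>n. real (n choose i) * G i)
      = ennreal (\<Sum>i\<le>Suc n. real (Suc n choose i) * G i)"
    by (subst sum_choose_Suc, subst ennreal_plus) (auto intro!: sum_nonneg)
  then show ?thesis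
    unfolding 1 2 by (simp only: posneg_vol_def G_def)
qed

section \<open>The volume of the region, one coordinate at a time\<close>

text \<open>Points are functions on an index set, so that an induction can remove one coordinate at
  a time; values outside \<open>A\<close> are unconstrained.\<close>

definition posneg_region :: "'a set \<Rightarrow> real \<Rightarrow> real \<Rightarrow> ('a \<Rightarrow> real) set" where
  "posneg_region A s t = {x. (\<Sum>i\<in>A. max 0 (x i)) \<le> s \<and> (\<Sum>i\<in>A. max 0 (- x i)) \<le> t}"

text \<open>The new coordinate contributes to at most one of the two sums, according to its sign,
  and lowers that bound by its absolute value. The range of \<open>y\<close> follows since the other
  terms are nonnegative.\<close>

lemma fun_upd_in_posneg_region_iff:
  assumes "b \<notin> A" "finite A"
  shows "x(b := y) \<in> posneg_region (insert b A) s t \<longleftrightarrow>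
    (if y \<ge> 0 then y \<in> {0..s} \<and> x \<in> posneg_region A (s - y) t
     else y \<in> {-t..0} \<and> x \<in> posneg_region A s (t + y))"
proof -
  have "(\<Sum>i\<in>A. max 0 ((x(b := y)) i)) = (\<Sum>i\<in>A. max 0 (x i))"
    "(\<Sum>i\<in>A. max 0 (- (x(b := y)) i)) = (\<Sum>i\<in>A. max 0 (- x i))"
    using assms by (auto intro!: sum.cong)
  moreover have "(\<Sum>i\<in>A. max 0 (x i)) \<ge> 0" "(\<Sum>i\<in>A. max 0 (- x i)) \<ge> 0"
    by (auto intro!: sum_nonneg)
  ultimately show ?thesis
    using assms by (auto simp: posneg_region_def)
qed

text \<open>Fubini: fixing one coordinate at \<open>y\<close> leaves a region in the remaining ones
  with one bound lowered, and \<open>posneg_vol_Suc\<close> integrates these slices.\<close>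

lemma emeasure_posneg_region:
  assumes "finite A" "s \<ge> 0" "t \<ge> 0"
  shows "emeasure (Pi\<^sub>M A (\<lambda>_. lborel)) (posneg_region A s t \<inter> space (Pi\<^sub>M A (\<lambda>_. lborel)))
       = ennreal (posneg_vol (card A) s t)"
  using assms
proof (induction arbitrary: s t rule: finite_induct)
  \<comment> \<open>The product over no coordinates is a single point of mass 1, which satisfies
    both bounds.\<close>
  case empty
  then show ?case
    by (simp add: PiM_empty posneg_region_def posneg_vol_def)
next
  case (insert b A s t)
  let ?M = "\<lambda>A. Pi\<^sub>M A (\<lambda>_. lborel :: real measure)"
  let ?R = "\<lambda>A s t. posneg_region A s t \<inter> space (?M A)"
  have meas [measurable]: "?R A s t \<in> sets (?M A)" if "finite A" for A :: "'a set" and s t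
  proof -
    have "?R A s t = {x \<in> space (?M A). (\<Sum>i\<in>A. max 0 (x i)) \<le> s \<and> (\<Sum>i\<in>A. max 0 (- x i)) \<le> t}"
      by (auto simp: posneg_region_def)
    also have "\<dots> \<in> sets (?M A)"
      by measurable
    finally show ?thesis .
  qed
  interpret product_sigma_finite "\<lambda>_::'a. lborel :: real measure" ..
  let ?f = "\<lambda>y. emeasure (?M A) (?R A (s - y) t) * indicator {0..s} y"
  let ?g = "\<lambda>y. emeasure (?M A) (?R A s (t + y)) * indicator {-t..0} y"
  \<comment> \<open>On the interval of the indicator the lowered bound is still nonnegative, so the
    induction hypothesis applies; elsewhere both sides are 0.\<close>
  have f_eq: "?f = (\<lambda>y. ennreal (posneg_vol (card A) (s - y) t) * indicator {0..s} y)"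
    using insert.IH insert.prems by (auto simp: fun_eq_iff indicator_def)
  have g_eq: "?g = (\<lambda>y. ennreal (posneg_vol (card A) s (t + y)) * indicator {-t..0} y)"
    using insert.IH insert.prems by (auto simp: fun_eq_iff indicator_def)
  have "emeasure (?M (insert b A)) (?R (insert b A) s t)
      = (\<integral>\<^sup>+ x. indicator (?R (insert b A) s t) x \<partial>?M (insert b A))"
    using insert.hyps by (subst nn_integral_indicator) auto
  also have "\<dots> = (\<integral>\<^sup>+ y. \<integral>\<^sup>+ x. indicator (?R (insert b A) s t) (x(b := y)) \<partial>?M A \<partial>lborel)"
    using insert.hyps by (intro product_nn_integral_insert_rev) auto
  \<comment> \<open>At \<open>y = 0\<close> both summands count the same slice; a single point is a
    null set, so equality almost everywhere suffices.\<close>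
  also have "\<dots> = (\<integral>\<^sup>+ y. ?f y + ?g y \<partial>lborel)"
  proof (rule nn_integral_cong_AE)
    have nz: "(\<integral>\<^sup>+ x. indicator (?R (insert b A) s t) (x(b := y)) \<partial>?M A) = ?f y + ?g y"
      if "y \<noteq> 0" for y
    proof -
      have "(\<integral>\<^sup>+ x. indicator (?R (insert b A) s t) (x(b := y)) \<partial>?M A)
          = (\<integral>\<^sup>+ x. indicator {0..s} y * indicator (?R A (s - y) t) x
              + indicator {-t..0} y * indicator (?R A s (t + y)) x \<partial>?M A)"
        using fun_upd_in_posneg_region_iff[OF insert.hyps(2,1), of _ y s t] that
        by (intro nn_integral_cong)
           (auto simp: indicator_def space_PiM PiE_def extensional_def)
      also have "\<dots> = ?f y + ?g y"
        using insert.hyps(1) by (simp add: nn_integral_add nn_integral_cmult mult.commute)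
      finally show ?thesis .
    qed
    show "AE y in lborel. (\<integral>\<^sup>+ x. indicator (?R (insert b A) s t) (x(b := y)) \<partial>?M A) = ?f y + ?g y"
      by (rule eventually_mono[OF AE_lborel_singleton[of 0]]) (rule nz)
  qed
  also have "\<dots> = (\<integral>\<^sup>+ y. ?f y \<partial>lborel) + (\<integral>\<^sup>+ y. ?g y \<partial>lborel)"
  proof (rule nn_integral_add)
    show "?f \<in> borel_measurable lborel" "?g \<in> borel_measurable lborel"
      unfolding f_eq g_eq posneg_vol_def by measurable
  qed
  also have "\<dots> = ennreal (posneg_vol (card (insert b A)) s t)"
    unfolding f_eq g_eq using insert.hyps insert.prems by (simp add: posneg_vol_Suc)
  finally show ?case .
qed

section \<open>The difference body of the standard simplex\<close>

text \<open>Points of \<open>S\<close> have nonnegative coordinates, so the positive parts of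
  \<open>\<mu> *\<^sub>R x - \<nu> *\<^sub>R y\<close> are at most the coordinates of
  \<open>\<mu> *\<^sub>R x\<close>, and the negative parts at most those of
  \<open>\<nu> *\<^sub>R y\<close>.\<close>

lemma std_simplex_difference:
  fixes \<mu> \<nu> :: real
  assumes "\<mu> > 0" "\<nu> > 0"
  defines "S \<equiv> convex hull (insert 0 Basis) :: 'a::euclidean_space set"
  shows "{\<mu> *\<^sub>R x - \<nu> *\<^sub>R y | x y. x \<in> S \<and> y \<in> S}
       = {z. (\<Sum>i\<in>Basis. max 0 (z \<bullet> i)) \<le> \<mu> \<and> (\<Sum>i\<in>Basis. max 0 (- (z \<bullet> i))) \<le> \<nu>}"
    (is "?L = ?R")
proof (intro equalityI subsetI)
  fix z assume "z \<in> ?L"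
  then obtain x y where z: "z = \<mu> *\<^sub>R x - \<nu> *\<^sub>R y" and x: "x \<in> S" and y: "y \<in> S" by blast
  have "(\<Sum>i\<in>Basis. max 0 (z \<bullet> i)) \<le> (\<Sum>i\<in>Basis. \<mu> * (x \<bullet> i))"
    using x y assms by (intro sum_mono) (auto simp: z S_def std_simplex inner_diff_left)
  also have "\<dots> \<le> \<mu>"
    using x assms by (simp add: S_def std_simplex flip: sum_distrib_left)
  finally have 1: "(\<Sum>i\<in>Basis. max 0 (z \<bullet> i)) \<le> \<mu>" .
  have "(\<Sum>i\<in>Basis. max 0 (- (z \<bullet> i))) \<le> (\<Sum>i\<in>Basis. \<nu> * (y \<bullet> i))"
    using x y assms by (intro sum_mono) (auto simp: z S_def std_simplex inner_diff_left)
  also have "\<dots> \<le> \<nu>"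
    using y assms by (simp add: S_def std_simplex flip: sum_distrib_left)
  finally show "z \<in> ?R" using 1 by simp
next
  fix z assume z: "z \<in> ?R"
  \<comment> \<open>The witnesses for the converse are the rescaled positive and negative parts of
    \<open>z\<close>, whose difference restores \<open>z\<close>; the two bounds put them in
    \<open>S\<close>.\<close>
  define x where "x = (\<Sum>i\<in>Basis. (max 0 (z \<bullet> i) / \<mu>) *\<^sub>R i)"
  define y where "y = (\<Sum>i\<in>Basis. (max 0 (- (z \<bullet> i)) / \<nu>) *\<^sub>R i)"
  have x: "x \<bullet> i = max 0 (z \<bullet> i) / \<mu>" and y: "y \<bullet> i = max 0 (- (z \<bullet> i)) / \<nu>"
    if "i \<in> Basis" for i
    using that by (simp_all add: x_def y_def)
  have "(\<Sum>i\<in>Basis. x \<bullet> i) = (\<Sum>i\<in>Basis. max 0 (z \<bullet> i)) / \<mu>"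
    unfolding sum_divide_distrib by (intro sum.cong refl x)
  moreover have "(\<Sum>i\<in>Basis. y \<bullet> i) = (\<Sum>i\<in>Basis. max 0 (- (z \<bullet> i))) / \<nu>"
    unfolding sum_divide_distrib by (intro sum.cong refl y)
  ultimately have "x \<in> S" "y \<in> S"
    using z assms(1,2) unfolding S_def std_simplex mem_Collect_eq by (simp_all add: x y)
  moreover have "z = \<mu> *\<^sub>R x - \<nu> *\<^sub>R y"
  proof (rule euclidean_eqI)
    fix i :: 'a assume "i \<in> Basis"
    then show "z \<bullet> i = (\<mu> *\<^sub>R x - \<nu> *\<^sub>R y) \<bullet> i"
      using assms(1,2) by (simp add: x y inner_diff_left max_def)
  qed
  ultimately show "z \<in> ?L" by blast
qed

lemma measure_std_simplex_difference:
  fixes \<mu> \<nu> :: real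
  assumes "\<mu> > 0" "\<nu> > 0"
  defines "S \<equiv> convex hull (insert 0 Basis) :: 'a::euclidean_space set"
  shows "measure lborel {\<mu> *\<^sub>R x - \<nu> *\<^sub>R y | x y. x \<in> S \<and> y \<in> S} = posneg_vol DIM('a) \<mu> \<nu>"
proof -
  let ?D = "{z::'a. (\<Sum>i\<in>Basis. max 0 (z \<bullet> i)) \<le> \<mu> \<and> (\<Sum>i\<in>Basis. max 0 (- (z \<bullet> i))) \<le> \<nu>}"
  \<comment> \<open>\<open>lborel\<close> is the image of the product measure under the map that
    assembles a vector from its coordinates; the preimage of \<open>?D\<close> is the region
    computed above.\<close>
  have "emeasure lborel ?D = emeasure (distr (Pi\<^sub>M Basis (\<lambda>b. lborel)) borel (\<lambda>f. \<Sum>b\<in>Basis. f b *\<^sub>R b)) ?D"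
    by (subst lborel_eq) simp
  also have "\<dots> = emeasure (Pi\<^sub>M Basis (\<lambda>b. lborel))
      (posneg_region Basis \<mu> \<nu> \<inter> space (Pi\<^sub>M (Basis :: 'a set) (\<lambda>b. lborel)))"
    by (subst emeasure_distr) (auto simp: posneg_region_def intro!: arg_cong2[where f = emeasure])
  also have "\<dots> = ennreal (posneg_vol DIM('a) \<mu> \<nu>)"
    using assms by (intro emeasure_posneg_region) auto
  finally show ?thesis
    using assms posneg_vol_nonneg[of \<mu> \<nu> "DIM('a)"]
    by (simp add: std_simplex_difference measure_def S_def)
qed

section \<open>Affine images and volume ratios\<close>

text \<open>Moving a vertex \<open>x0\<close> to the origin turns the other vertices into
  \<open>DIM('a)\<close> independent vectors, hence a basis; \<open>g\<close> carries the standard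
  basis to it.\<close>

lemma simplex_eq_affine_image:
  fixes T :: "'a::euclidean_space set"
  assumes "int DIM('a) simplex T"
  obtains x0 :: 'a and g :: "'a \<Rightarrow> 'a" where "linear g" "bij g"
    "T = (+) x0 ` g ` (convex hull (insert 0 Basis))"
proof -
  obtain C where C: "\<not> affine_dependent C" "card C = Suc DIM('a)" "T = convex hull C"
    using assms by (auto simp: simplex_def)
  then obtain x0 where x0: "x0 \<in> C" by fastforce
  define B where "B = (\<lambda>x. -x0 + x) ` (C - {x0})"
  have "finite C" using C(2) by (simp add: card_ge_0_finite)
  have indep: "independent B"
    using C(1) affine_dependent_iff_dependent2[OF x0] by (simp add: B_def)
  have cardB: "card B = DIM('a)"
    using C(2) x0 \<open>finite C\<close> unfolding B_def by (subst card_image) auto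
  have spanB: "UNIV \<subseteq> span B"
    using indep cardB by (intro card_ge_dim_independent) auto
  have "\<exists>g :: 'a \<Rightarrow> 'a. linear g \<and> g ` Basis = B \<and> g ` UNIV = UNIV \<and> inj_on g UNIV"
    by (rule basis_to_basis_subspace_isomorphism)
      (use indep cardB spanB in \<open>auto simp: independent_Basis\<close>)
  then obtain g :: "'a \<Rightarrow> 'a" where g: "linear g" "g ` Basis = B" "surj g" "inj g"
    by blast
  have "(+) x0 ` insert 0 B = C"
    using x0 by (auto simp: B_def image_iff)
  then have "T = (+) x0 ` (convex hull (insert 0 B))"
    using C(3) convex_hull_translation by metis
  also have "insert 0 B = g ` insert 0 Basis"
    using g by (simp add: linear_0)
  also have "convex hull \<dots> = g ` (convex hull (insert 0 Basis))"
    using g by (metis convex_hull_linear_image)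
  finally show thesis
    using that g by (auto simp: bij_def)
qed

text \<open>The scaling factor of \<open>g\<close> cancels in the quotient. Separate shifts
  \<open>a\<close> and \<open>b\<close> are allowed because the difference body and the simplex are
  displaced differently.\<close>

lemma measure_affine_image_ratio:
  fixes g :: "'a::euclidean_space \<Rightarrow> 'b::euclidean_space" and a b :: 'b
  assumes g: "linear g" "bij g" and A: "compact A" and B: "compact B"
    and pos: "measure lborel B > 0"
  shows "measure lebesgue ((+) a ` g ` A) / measure lebesgue ((+) b ` g ` B)
       = measure lborel A / measure lborel B"
proof -
  have compact_image: "compact (g ` X)" if "compact X" for X
    using that g by (intro compact_continuous_image linear_continuous_on)
      (auto simp: linear_conv_bounded_linear)
  have lebesgue_eq: "measure lebesgue ((+) c ` g ` X) = measure lborel (g ` X)" if "compact X" for c X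
    using compact_image[OF that] by (simp add: measure_translation borel_compact)
  have ratio: "measure lborel (g ` X) * measure lborel Y = measure lborel X * measure lborel (g ` Y)"
    if "compact X" "compact Y" for X Y
    using emeasure_linear_image_ratio[OF g, of X Y] that
    by (simp add: measure_def borel_compact flip: enn2real_mult)
  \<comment> \<open>The denominator must not vanish: otherwise the ratio identity, applied to the
    preimage \<open>Q\<close> of the unit ball and to \<open>B\<close>, would make a product of two
    positive volumes zero.\<close>
  have "measure lborel (g ` B) \<noteq> 0"
  proof
    assume zero: "measure lborel (g ` B) = 0"
    have lin: "linear (inv g)"
      using g by (rule linear_inv_bij)
    define Q where "Q = inv g ` cball 0 1"
    have "compact Q"
      unfolding Q_def using lin
      by (intro compact_continuous_image linear_continuous_on) (auto simp: linear_conv_bounded_linear)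
    moreover have "g ` Q = cball 0 1"
      using g(2) by (simp add: Q_def bij_def image_f_inv_f)
    ultimately have "measure lborel (cball (0::'b) 1) * measure lborel B = 0"
      using ratio[of Q B] B zero by simp
    then show False
      using pos content_cball_pos[of 1 "0::'b"] by simp
  qed
  then show ?thesis
    unfolding lebesgue_eq[OF A] lebesgue_eq[OF B]
    using ratio[OF A B] pos by (simp add: field_simps)
qed

section \<open>Transfer to an arbitrary simplex\<close>

theorem theorem1:
  fixes T :: "(real ^ 'n::finite) set" and \<mu> \<nu> :: real
  assumes "int CARD('n) simplex T"
    and "\<mu> > 0" and "\<nu> > 0"
  shows "measure lebesgue {\<mu> *\<^sub>R x - \<nu> *\<^sub>R y | x y. x \<in> T \<and> y \<in> T} / measure lebesgue T
       = (\<Sum>i=0..CARD('n). (real (CARD('n) choose i))\<^sup>2 * \<mu> ^ i * \<nu> ^ (CARD('n) - i))"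
proof -
  define S :: "(real ^ 'n) set" where "S = convex hull (insert 0 Basis)"
  define D where "D = {\<mu> *\<^sub>R x - \<nu> *\<^sub>R y | x y. x \<in> S \<and> y \<in> S}"
  let ?n = "CARD('n)"
  have "int DIM(real ^ 'n) simplex T"
    using assms(1) by simp
  then obtain x0 g where g: "linear g" "bij g" and T: "T = (+) x0 ` g ` S"
    unfolding S_def by (rule simplex_eq_affine_image)
  have S: "compact S"
    unfolding S_def by (intro finite_imp_compact_convex_hull) auto
  have "compact {x - y | x y. x \<in> (*\<^sub>R) \<mu> ` S \<and> y \<in> (*\<^sub>R) \<nu> ` S}"
    by (intro compact_differences compact_scaling S)
  also have "{x - y | x y. x \<in> (*\<^sub>R) \<mu> ` S \<and> y \<in> (*\<^sub>R) \<nu> ` S} = D"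
    by (auto simp: D_def)
  finally have D: "compact D" .
  \<comment> \<open>The two copies of \<open>x0\<close> combine into the constant displacement
    \<open>(\<mu> - \<nu>) *\<^sub>R x0\<close>, which does not affect volume.\<close>
  have shift: "\<mu> *\<^sub>R (x0 + g x) - \<nu> *\<^sub>R (x0 + g y) = (\<mu> - \<nu>) *\<^sub>R x0 + g (\<mu> *\<^sub>R x - \<nu> *\<^sub>R y)" for x y
    by (simp add: linear_diff[OF g(1)] linear_scale[OF g(1)] algebra_simps)
  \<comment> \<open>Written as an image of \<open>X \<times> X\<close>, the set can be transformed
    by composing maps.\<close>
  have pairs: "{\<mu> *\<^sub>R x - \<nu> *\<^sub>R y | x y. x \<in> X \<and> y \<in> X}
      = (\<lambda>(x, y). \<mu> *\<^sub>R x - \<nu> *\<^sub>R y) ` (X \<times> X)" for X :: "(real ^ 'n) set"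
    by auto
  have "T \<times> T = (\<lambda>(x, y). (x0 + g x, x0 + g y)) ` (S \<times> S)"
    unfolding T by (auto simp: image_iff Bex_def)
  then have "{\<mu> *\<^sub>R x - \<nu> *\<^sub>R y | x y. x \<in> T \<and> y \<in> T}
      = (\<lambda>(x, y). \<mu> *\<^sub>R (x0 + g x) - \<nu> *\<^sub>R (x0 + g y)) ` (S \<times> S)"
    by (simp only: pairs image_image split_def fst_conv snd_conv)
  also have "\<dots> = (+) ((\<mu> - \<nu>) *\<^sub>R x0) ` g ` (\<lambda>(x, y). \<mu> *\<^sub>R x - \<nu> *\<^sub>R y) ` (S \<times> S)"
    by (simp only: image_image split_def shift)
  also have "(\<lambda>(x, y). \<mu> *\<^sub>R x - \<nu> *\<^sub>R y) ` (S \<times> S) = D"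
    by (simp only: pairs D_def)
  finally have "{\<mu> *\<^sub>R x - \<nu> *\<^sub>R y | x y. x \<in> T \<and> y \<in> T} = (+) ((\<mu> - \<nu>) *\<^sub>R x0) ` g ` D" .
  then have "measure lebesgue {\<mu> *\<^sub>R x - \<nu> *\<^sub>R y | x y. x \<in> T \<and> y \<in> T} / measure lebesgue T
      = measure lborel D / measure lborel S"
    unfolding T using measure_affine_image_ratio[OF g D S] by (simp add: S_def content_std_simplex)
  \<comment> \<open>\<open>S\<close> has volume \<open>1 / fact ?n\<close>, whence the
    factor.\<close>
  also have "\<dots> = fact ?n * posneg_vol ?n \<mu> \<nu>"
    using assms by (simp add: S_def D_def content_std_simplex measure_std_simplex_difference)
  \<comment> \<open>\<open>fact ?n / (fact i * fact (?n - i))\<close> is a second binomial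
    coefficient, whence the square.\<close>
  also have "\<dots> = (\<Sum>i\<le>?n. (real (?n choose i))\<^sup>2 * \<mu> ^ i * \<nu> ^ (?n - i))"
    unfolding posneg_vol_def sum_distrib_left
    by (intro sum.cong) (auto simp: binomial_fact power2_eq_square)
  finally show ?thesis
    by (simp add: atMost_atLeast0)
qed

end
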